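(* Every evolving group is supersolvable.
   Context: A group $G$ is called evolving if it is finite and if, for every prime number $p$ and for every $p$-subgroup $I$ of $G$, there exists a subgroup $J$ of $G$ that contains $I$ and such that $|G:J|$ is a power of $p$ and $|J:I|$ is coprime to $p$. *)

theory Defs
  imports
    "HOL-Algebra.Elementary_Groups"
    "HOL-Computational_Algebra.Primes"
begin

definition subgroup_index :: "('a, 'b) monoid_scheme \<Rightarrow> 'a set \<Rightarrow> nat" where
  "subgroup_index G H = card (rcosets\<^bsub>G\<^esub> H)"

definition p_subgroup :: "nat \<Rightarrow> 'a set \<Rightarrow> ('a, 'b) monoid_scheme \<Rightarrow> bool" where
  "p_subgroup p H G \<longleftrightarrow> subgroup H G \<and> (\<exists>n. card H = p ^ n)"

definition evolving :: "('a, 'b) monoid_scheme \<Rightarrow> bool" where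
  "evolving G \<longleftrightarrow> group G \<and> finite (carrier G) \<and>
    (\<forall>p I. prime p \<and> p_subgroup p I G \<longrightarrow>
      (\<exists>J. subgroup J G \<and> I \<subseteq> J \<and>
           (\<exists>n. subgroup_index G J = p ^ n) \<and>
           coprime (subgroup_index (G\<lparr>carrier := J\<rparr>) I) p))"

text \<open>
  Every term of the series is required to be normal in the whole group \<open>G\<close>; requiring
  \<open>N i\<close> to be normal only in \<open>N (Suc i)\<close> would define polycyclic groups.
\<close>

definition supersolvable :: "('a, 'b) monoid_scheme \<Rightarrow> bool" where
  "supersolvable G \<longleftrightarrow> group G \<and>
    (\<exists>(N :: nat \<Rightarrow> 'a set) r. N 0 = {\<one>\<^bsub>G\<^esub>} \<and> N r = carrier G \<and>
      (\<forall>i\<le>r. N i \<lhd> G) \<and>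
      (\<forall>i<r. N i \<subseteq> N (Suc i) \<and> cyclic_group ((G\<lparr>carrier := N (Suc i)\<rparr>) Mod N i)))"

end

theory Submission
  imports
    Defs
    "HOL-Algebra.Multiplicative_Group"
    "HOL-Algebra.Group_Action"
    "HOL-Algebra.Sylow"
begin

text \<open>
  Normal subgroups and quotients of evolving groups are evolving. If \<open>p\<close> is the
  smallest prime divisor of \<open>|G|\<close> and \<open>p^a\<close> its full power in
  \<open>|G|\<close>, a subgroup of order \<open>p^(a-1)\<close> yields a subgroup of index
  \<open>p\<close>, which is normal; by induction the Sylow subgroup \<open>Q\<close> for the
  largest prime \<open>q\<close> is normal in \<open>G\<close>. For a subgroup \<open>I\<close> of
  order \<open>q\<close> in the centre of \<open>Q\<close>, the subgroup \<open>J\<close> provided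
  by the evolving property meets \<open>Q\<close> exactly in \<open>I\<close>, so \<open>I\<close>
  is normalized by \<open>J\<close> as well as by \<open>Q\<close>, and hence by \<open>G\<close>.
  Thus every nontrivial evolving group has a normal subgroup of prime order; applied to successive
  quotients this produces the series.
\<close>

section \<open>Orders and indices under homomorphisms\<close>

lemma (in group) lagrange_pair:
  assumes "subgroup A G" "subgroup B G" "A \<subseteq> B"
  obtains x where "card B = x * card A"
proof -
  have "subgroup A (G\<lparr>carrier := B\<rparr>)"
    using assms subgroup_incl by blast
  then have "card (rcosets\<^bsub>G\<lparr>carrier := B\<rparr>\<^esub> A) * card A = card B"
    using group.lagrange[OF subgroup_imp_group[OF assms(2)]] by (simp add: order_def)
  then show ?thesis using that by metis
qed

lemma (in group) card_pos_subgroup: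
  assumes "finite (carrier G)" "subgroup A G"
  shows "0 < card A"
  using assms subgroup.finite_imp_card_positive by blast

text \<open>First isomorphism theorem for \<open>h\<close> restricted to \<open>K\<close>, combined
  with Lagrange.\<close>

lemma (in group_hom) card_eq_kernel_times_image:
  assumes "subgroup K G"
  shows "card K = card (K \<inter> kernel G H h) * card (h ` K)"
proof -
  let ?K = "G\<lparr>carrier := K\<rparr>" and ?H = "H\<lparr>carrier := h ` K\<rparr>"
  interpret r: group_hom ?K ?H h
    using induced_group_hom[OF assms] .
  have ker: "kernel ?K ?H h = K \<inter> kernel G H h"
    using subgroup.subset[OF assms] by (auto simp: kernel_def)
  have "?K Mod kernel ?K ?H h \<cong> ?H"
    by (rule r.FactGroup_iso) simp
  then have "card (carrier (?K Mod kernel ?K ?H h)) = card (h ` K)"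
    using iso_same_card by fastforce
  moreover have "card (rcosets\<^bsub>?K\<^esub> (kernel ?K ?H h)) * card (kernel ?K ?H h) = card K"
    using r.G.lagrange[OF r.subgroup_kernel] by (simp add: order_def)
  ultimately show ?thesis
    by (simp add: FactGroup_def ker mult.commute)
qed

text \<open>The index of \<open>A\<close> in \<open>B\<close> is the product of the index
  \<open>x\<close> seen in the images and the index \<open>y\<close> seen in the kernel. Both
  factors divide it, so being a power of \<open>p\<close> or being coprime to \<open>p\<close>
  passes to each: \<open>y\<close> serves normal subgroups, \<open>x\<close> serves
  quotients.\<close>

lemma (in group_hom) index_split:
  assumes fin: "finite (carrier G)" and A: "subgroup A G" and B: "subgroup B G" and "A \<subseteq> B"
  obtains x y where "card (h ` B) = x * card (h ` A)"
    "card (B \<inter> kernel G H h) = y * card (A \<inter> kernel G H h)"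
    "card B = x * y * card A"
proof -
  obtain x where x: "card (h ` B) = x * card (h ` A)"
    using H.lagrange_pair[OF subgroup_img_is_subgroup[OF A] subgroup_img_is_subgroup[OF B]] \<open>A \<subseteq> B\<close>
    by (metis image_mono)
  have k: "subgroup (C \<inter> kernel G H h) G" if "subgroup C G" for C
    using that G.subgroups_Inter_pair subgroup_kernel by blast
  obtain y where y: "card (B \<inter> kernel G H h) = y * card (A \<inter> kernel G H h)"
    using G.lagrange_pair[OF k[OF A] k[OF B]] \<open>A \<subseteq> B\<close> by (metis Int_mono order_refl)
  have "card B = x * y * card A"
    using card_eq_kernel_times_image[OF A] card_eq_kernel_times_image[OF B] x y by simp
  with x y that show ?thesis by blast
qed

lemma (in group_hom) subgroup_preimage:
  assumes "subgroup K H"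
  shows "subgroup {x \<in> carrier G. h x \<in> K} G"
proof (rule G.subgroupI)
  interpret K: subgroup K H by fact
  show "{x \<in> carrier G. h x \<in> K} \<noteq> {}"
    using K.one_closed G.one_closed hom_one by force
  show "inv a \<in> {x \<in> carrier G. h x \<in> K}" if "a \<in> {x \<in> carrier G. h x \<in> K}" for a
    using that by simp
  show "a \<otimes> b \<in> {x \<in> carrier G. h x \<in> K}"
    if "a \<in> {x \<in> carrier G. h x \<in> K}" "b \<in> {x \<in> carrier G. h x \<in> K}" for a b
    using that by simp
qed auto

lemma (in normal) group_hom_Mod: "group_hom G (G Mod H) (\<lambda>a. H #> a)"
  using factorgroup_is_group r_coset_hom_Mod is_group
  by (simp add: group_hom_def group_hom_axioms_def)

lemma (in normal) kernel_Mod: "kernel G (G Mod H) (\<lambda>a. H #> a) = H"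
proof -
  have "H #> x = H \<longleftrightarrow> x \<in> H" if "x \<in> carrier G" for x
    using coset_join1[OF _ that subgroup_axioms] coset_join2[OF that subgroup_axioms] by blast
  then show ?thesis using subset by (auto simp: kernel_def)
qed

section \<open>Evolving groups: normal subgroups and homomorphic images\<close>

lemma evolvingI:
  assumes "group G" "finite (carrier G)"
    and *: "\<And>p n I. \<lbrakk>prime p; subgroup I G; card I = p ^ n\<rbrakk> \<Longrightarrow>
      \<exists>J m k. subgroup J G \<and> I \<subseteq> J \<and> card (carrier G) = p ^ m * card J \<and>
        card J = k * card I \<and> coprime k p"
  shows "evolving G"
  unfolding evolving_def p_subgroup_def
proof (intro conjI allI impI assms(1,2))
  interpret group G by fact
  fix p I assume "prime p \<and> subgroup I G \<and> (\<exists>n. card I = p ^ n)"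
  then obtain J m k where I: "subgroup I G" and J: "subgroup J G" "I \<subseteq> J" "card (carrier G) = p ^ m * card J"
    "card J = k * card I" "coprime k p"
    using * by meson
  have "subgroup I (G\<lparr>carrier := J\<rparr>)"
    using I J subgroup_incl by blast
  then have "subgroup_index (G\<lparr>carrier := J\<rparr>) I * card I = k * card I"
    using group.lagrange[OF subgroup_imp_group[OF J(1)]] J(4)
    by (simp add: order_def subgroup_index_def)
  moreover have "subgroup_index G J * card J = p ^ m * card J"
    using lagrange[OF J(1)] J(3) by (simp add: order_def subgroup_index_def)
  ultimately have "subgroup_index (G\<lparr>carrier := J\<rparr>) I = k" "subgroup_index G J = p ^ m"
    using card_pos_subgroup[OF assms(2)] I J(1) by (metis less_not_refl mult_cancel2)+
  with J show "\<exists>J. subgroup J G \<and> I \<subseteq> J \<and> (\<exists>n. subgroup_index G J = p ^ n) \<and>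
           coprime (subgroup_index (G\<lparr>carrier := J\<rparr>) I) p"
    by blast
qed

lemma evolvingD:
  assumes "evolving G"
  shows "group G" "finite (carrier G)"
  using assms by (auto simp: evolving_def)

text \<open>As in \<open>evolvingI\<close>, indices appear as factors of cardinalities, the form in
  which \<open>index_split\<close> can divide them up without counting cosets.\<close>

lemma evolvingE:
  assumes "evolving G" "prime p" "subgroup I G" "card I = p ^ n"
  obtains J m k where "subgroup J G" "I \<subseteq> J" "card (carrier G) = p ^ m * card J"
    "card J = k * card I" "coprime k p"
proof -
  interpret group G using assms evolvingD by blast
  obtain J m where J: "subgroup J G" "I \<subseteq> J" "subgroup_index G J = p ^ m"
    "coprime (subgroup_index (G\<lparr>carrier := J\<rparr>) I) p"
    using assms unfolding evolving_def p_subgroup_def by meson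
  have "subgroup I (G\<lparr>carrier := J\<rparr>)"
    using assms J subgroup_incl by blast
  then have "subgroup_index (G\<lparr>carrier := J\<rparr>) I * card I = card J"
    using group.lagrange[OF subgroup_imp_group[OF J(1)]]
    by (simp add: order_def subgroup_index_def)
  moreover have "p ^ m * card J = card (carrier G)"
    using lagrange[OF J(1)] J(3) by (simp add: order_def subgroup_index_def)
  ultimately show ?thesis using that J by metis
qed

text \<open>If \<open>J\<close> works for \<open>I\<close> in \<open>G\<close>, then
  \<open>J \<inter> N\<close> works for \<open>I\<close> in \<open>N\<close>: its two indices are
  the kernel factors, for the map onto \<open>G Mod N\<close>, of the two indices belonging to
  \<open>J\<close>.\<close>

lemma evolving_normal_subgroup:
  fixes G (structure)
  assumes ev: "evolving G" and N: "N \<lhd> G"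
  shows "evolving (G\<lparr>carrier := N\<rparr>)"
proof -
  interpret normal N G by fact
  interpret f: group_hom G "G Mod N" "\<lambda>a. N #> a" by (rule group_hom_Mod)
  have fin: "finite (carrier G)" using ev evolvingD by blast
  show ?thesis
  proof (rule evolvingI)
    show "group (G\<lparr>carrier := N\<rparr>)" by (simp add: subgroup_imp_group subgroup_axioms)
    show "finite (carrier (G\<lparr>carrier := N\<rparr>))" using fin subset finite_subset by auto
  next
    fix p n I assume p: "prime (p::nat)" and I: "subgroup I (G\<lparr>carrier := N\<rparr>)" and n: "card I = p ^ n"
    have IG: "subgroup I G" using I incl_subgroup subgroup_axioms by blast
    have IN: "I \<subseteq> N" using subgroup.subset[OF I] by simp
    obtain J m k where J: "subgroup J G" "I \<subseteq> J" "card (carrier G) = p ^ m * card J"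
      "card J = k * card I" "coprime k p"
      using evolvingE[OF ev p IG n] .
    have pos: "0 < card I" "0 < card J" using card_pos_subgroup fin IG J(1) by blast+
    obtain x y where xy: "card N = y * card (J \<inter> N)" "card (carrier G) = x * y * card J"
      using f.index_split[OF fin J(1) subgroup_self subgroup.subset[OF J(1)]] kernel_Mod subset
      by (metis Int_absorb1)
    then have "x * y = p ^ m" using J(3) pos by simp
    then obtain i where i: "y = p ^ i"
      using divides_primepow_nat[OF p] by (metis dvd_triv_right)
    obtain z w where zw: "card (J \<inter> N) = w * card (I \<inter> N)" "card J = z * w * card I"
      using f.index_split[OF fin IG J(1,2)] kernel_Mod by metis
    then have "z * w = k" using J(4) pos by simp
    then have "coprime w p" using J(5) by auto
    moreover have "subgroup (J \<inter> N) (G\<lparr>carrier := N\<rparr>)"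
      using J(1) subgroup_axioms subgroups_Inter_pair subgroup_incl by blast
    moreover have "card (J \<inter> N) = w * card I" using zw IN by (simp add: Int_absorb2)
    ultimately show "\<exists>J m k. subgroup J (G\<lparr>carrier := N\<rparr>) \<and> I \<subseteq> J \<and>
        card (carrier (G\<lparr>carrier := N\<rparr>)) = p ^ m * card J \<and> card J = k * card I \<and> coprime k p"
      using J(2) IN i xy by (intro exI[of _ "J \<inter> N"] exI[of _ i] exI[of _ w]) auto
  qed
qed

text \<open>A \<open>p\<close>-subgroup \<open>I'\<close> of \<open>H\<close> is lifted to a
  \<open>p\<close>-subgroup \<open>I\<close> of \<open>G\<close> with image \<open>I'\<close>. The
  image of a subgroup \<open>J\<close> that works for \<open>I\<close> then works for
  \<open>I'\<close>, by the image factors of \<open>index_split\<close>.\<close>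

lemma evolving_epimorphic_image:
  assumes ev: "evolving G" and hom: "group_hom G H h" and surj: "h ` carrier G = carrier H"
  shows "evolving H"
proof -
  interpret group_hom G H h by fact
  have fin: "finite (carrier G)" using ev evolvingD by blast
  then have finH: "finite (carrier H)" using surj by (metis finite_imageI)
  show ?thesis
  proof (rule evolvingI[OF H.is_group finH])
    fix p n I' assume p: "prime (p::nat)" and I': "subgroup I' H" and n: "card I' = p ^ n"
    define L where "L = {x \<in> carrier G. h x \<in> I'}"
    have L: "subgroup L G" unfolding L_def using subgroup_preimage[OF I'] .
    have hL: "h ` L = I'"
      using surj subgroup.subset[OF I'] unfolding L_def by (auto simp: image_iff subset_iff)
    have Lpos: "card L \<noteq> 0" using G.card_pos_subgroup[OF fin L] by simp
    \<comment> \<open>The full preimage \<open>L\<close> need not be a \<open>p\<close>-group, so it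
      is replaced by one of its Sylow \<open>p\<close>-subgroups.\<close>
    obtain a m where am: "card L = p ^ a * m" "\<not> p dvd m"
      by (rule multiplicity_decompose'[of "card L" p]) (use Lpos p in auto)
    obtain I where IL: "subgroup I (G\<lparr>carrier := L\<rparr>)" and cI: "card I = p ^ a"
      using sylow_thm[OF p G.subgroup_imp_group[OF L], of a m] am fin L
      by (auto simp: order_def dest: subgroup.subset finite_subset)
    have I: "subgroup I G" using IL L G.incl_subgroup by blast
    have IsubL: "I \<subseteq> L" using subgroup.subset[OF IL] by simp
    have Ipos: "0 < card I" using G.card_pos_subgroup fin I by blast
    obtain d c where dc: "card I' = d * card (h ` I)" "card L = d * c * card I"
      using index_split[OF fin I L IsubL] hL by metis
    \<comment> \<open>The index \<open>d\<close> of the image of \<open>I\<close> in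
      \<open>I'\<close> divides both a power of \<open>p\<close> and \<open>m\<close>, which is
      prime to \<open>p\<close>. Hence \<open>d = 1\<close> and \<open>I\<close> still maps onto
      \<open>I'\<close>.\<close>
    have "d * c = m" using dc(2) am(1) cI p by (simp add: mult.commute)
    then have "\<not> p dvd d" using am(2) by auto
    moreover have "d dvd p ^ n" using dc(1) n by (metis dvd_triv_left)
    ultimately have "d = 1"
      using divides_primepow_nat[OF p] by (metis dvd_power gr0I power_0)
    then have hI: "h ` I = I'"
      using dc(1) hL IsubL finH subgroup.subset[OF I']
      by (metis card_subset_eq finite_subset image_mono mult_1)
    obtain J s k where J: "subgroup J G" "I \<subseteq> J" "card (carrier G) = p ^ s * card J"
      "card J = k * card I" "coprime k p"
      using evolvingE[OF ev p I cI] .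
    have Jpos: "0 < card J" using G.card_pos_subgroup fin J by blast
    obtain x y where xy: "card (carrier H) = x * card (h ` J)" "card (carrier G) = x * y * card J"
      using index_split[OF fin J(1) G.subgroup_self subgroup.subset[OF J(1)]] surj by metis
    then have "x * y = p ^ s" using J(3) Jpos by simp
    then obtain i where i: "x = p ^ i"
      using divides_primepow_nat[OF p] by (metis dvd_triv_left)
    obtain z w where zw: "card (h ` J) = z * card (h ` I)" "card J = z * w * card I"
      using index_split[OF fin I J(1,2)] by metis
    then have "z * w = k" using J(4) Ipos by simp
    then have "coprime z p" using J(5) by auto
    then show "\<exists>J m k. subgroup J H \<and> I' \<subseteq> J \<and> card (carrier H) = p ^ m * card J \<and>
        card J = k * card I' \<and> coprime k p"
      using subgroup_img_is_subgroup[OF J(1)] J(2) hI xy(1) zw(1) i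
      by (intro exI[of _ "h ` J"] exI[of _ i] exI[of _ z]) auto
  qed
qed

section \<open>Subgroups whose index is minimal among the prime divisors\<close>

lemma (in group) coprime_pow_in_subgroup:
  assumes fin: "finite (carrier G)" and J: "subgroup J G" and g: "g \<in> carrier G"
    and d: "g [^] (d::nat) \<in> J" "coprime d (order G)"
  shows "g \<in> J"
proof -
  have "order G \<noteq> 0" using fin order_gt_0_iff_finite by simp
  show ?thesis
  proof (cases "d = 0")
    case True
    then have "order G = 1" using d(2) by simp
    then have "carrier G = {\<one>}" using order_one_triv_iff by blast
    then show ?thesis using g subgroup.one_closed[OF J] by simp
  next
    case False
    \<comment> \<open>A Bezout identity over the naturals, available as \<open>d\<close> is nonzero:
      modulo the group order, \<open>e\<close> inverts \<open>d\<close>, so \<open>g\<close> is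
      itself a power of \<open>g [^] d\<close>.\<close>
    then obtain e y where e: "d * e = order G * y + 1"
      using bezout_nat[of d "order G"] d(2) by (metis coprime_imp_gcd_eq_1)
    have "(g [^] d) [^] e = (g [^] order G) [^] y \<otimes> g"
      using g e by (simp add: nat_pow_pow)
    then have "g = (g [^] d) [^] e"
      using g by (simp add: pow_order_eq_1)
    also have "\<dots> \<in> J"
    proof (induction e)
      case 0 then show ?case using J subgroup.one_closed by simp
    next
      case (Suc e) then show ?case using J d(1) subgroup.m_closed by fastforce
    qed
    finally show ?thesis .
  qed
qed

lemma (in group) conjugation_pow:
  assumes "x \<in> carrier G" "h \<in> carrier G"
  shows "(x \<otimes> h \<otimes> inv x) [^] (k::nat) = x \<otimes> h [^] k \<otimes> inv x"
proof (induction k)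
  case (Suc k)
  have "inv x \<otimes> (x \<otimes> y) = y" if "y \<in> carrier G" for y
    using that assms by (simp flip: m_assoc)
  with Suc show ?case using assms by (simp add: m_assoc)
qed (use assms in simp)

text \<open>The cosets of \<open>g [^] i\<close> for \<open>i < p\<close> are distinct, and there
  are only \<open>p\<close> cosets. If two agreed, a power of \<open>g\<close> with exponent
  strictly between \<open>0\<close> and \<open>p\<close> would lie in \<open>J\<close>; no prime
  divisor of the group order is that small, so the exponent is coprime to the order and
  \<open>g\<close> itself would lie in \<open>J\<close>.\<close>

lemma (in group) prime_index_cosets:
  assumes fin: "finite (carrier G)" and J: "subgroup J G" and card: "order G = p * card J"
    and small: "\<And>q. \<lbrakk>prime q; q dvd order G\<rbrakk> \<Longrightarrow> p \<le> q"
    and g: "g \<in> carrier G" "g \<notin> J" and x: "x \<in> carrier G"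
  shows "\<exists>h\<in>J. \<exists>i::nat. x = h \<otimes> g [^] i"
proof -
  have "card J \<noteq> 0" using card_pos_subgroup[OF fin J] by simp
  then have ci: "card (rcosets J) = p"
    using lagrange[OF J] card by simp
  let ?f = "\<lambda>i::nat. J #> g [^] i"
  have lt: False if "i < j" "j < p" "?f i = ?f j" for i j
  proof -
    have "g [^] j \<in> J #> g [^] i"
      using that(3) rcos_self[OF _ J] g(1) by simp
    then have "g [^] j \<otimes> inv (g [^] i) \<in> J"
      using subgroup.rcos_module_imp[OF J is_group] g(1) by simp
    also have "g [^] j \<otimes> inv (g [^] i) = g [^] (j - i)"
      using g(1) that(1) nat_pow_mult[of g "j - i" i] by (simp add: inv_solve_right')
    finally have d: "g [^] (j - i) \<in> J" .
    have "coprime (j - i) (order G)"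
    proof (rule ccontr)
      assume "\<not> coprime (j - i) (order G)"
      then obtain q where q: "prime q" "q dvd j - i" "q dvd order G"
        using prime_factor_nat[of "gcd (j - i) (order G)"] by (auto simp: coprime_iff_gcd_eq_1)
      then show False
        using small[OF q(1,3)] dvd_imp_le[OF q(2)] that(1,2) by simp
    qed
    then show False
      using coprime_pow_in_subgroup[OF fin J g(1) d] g(2) by blast
  qed
  have "inj_on ?f {..<p}"
    by (rule linorder_inj_onI') (use lt in auto)
  then have "card (?f ` {..<p}) = card (rcosets J)"
    by (simp add: ci card_image)
  moreover have "?f ` {..<p} \<subseteq> rcosets J"
    using g(1) rcosetsI[OF subgroup.subset[OF J]] by auto
  moreover have "finite (rcosets J)"
    using rcosets_subset_PowG[OF J] fin by (meson finite_Pow_iff finite_subset)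
  ultimately have "?f ` {..<p} = rcosets J"
    using card_subset_eq by blast
  then have "J #> x \<in> ?f ` {..<p}"
    using rcosetsI[OF subgroup.subset[OF J] x] by simp
  then obtain i where "J #> x = ?f i" by blast
  then have "x \<in> J #> g [^] i" using rcos_self[OF x J] by simp
  then show ?thesis unfolding r_coset_def by blast
qed

text \<open>
  If \<open>g = x \<otimes> j \<otimes> inv x\<close> were outside \<open>J\<close>, the powers of \<open>g\<close> would represent all right cosets
  of \<open>J\<close>; writing \<open>inv x\<close> in this form puts \<open>x\<close> into \<open>J\<close>.
\<close>

lemma (in group) smallest_prime_index_normal:
  assumes fin: "finite (carrier G)" and J: "subgroup J G" and card: "order G = p * card J"
    and small: "\<And>q. \<lbrakk>prime q; q dvd order G\<rbrakk> \<Longrightarrow> p \<le> q"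
  shows "J \<lhd> G"
proof (rule normal_invI[OF J], rule ccontr)
  fix x j assume x: "x \<in> carrier G" and j: "j \<in> J" and notin: "x \<otimes> j \<otimes> inv x \<notin> J"
  interpret J: subgroup J G by fact
  have jG: "j \<in> carrier G" using j by simp
  obtain h i where h: "h \<in> J" and eq: "inv x = h \<otimes> (x \<otimes> j \<otimes> inv x) [^] (i::nat)"
    using prime_index_cosets[OF fin J card small _ notin, of "inv x"] x jG by auto
  have "(x \<otimes> j \<otimes> inv x) [^] i = x \<otimes> j [^] i \<otimes> inv x"
    using conjugation_pow x jG by blast
  with eq have "inv x = h \<otimes> x \<otimes> j [^] i \<otimes> inv x"
    using x jG h by (simp add: m_assoc)
  then have "h \<otimes> x \<otimes> j [^] i = \<one>"
    using x jG h by (metis J.mem_carrier inv_closed m_closed nat_pow_closed r_cancel_one')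
  then have "x = inv h \<otimes> inv (j [^] i)"
    using x jG h by (metis J.mem_carrier inv_closed inv_equality inv_inv inv_solve_left m_assoc m_closed nat_pow_closed r_one)
  moreover have "j [^] i \<in> J"
    using j by (induction i) auto
  ultimately have "x \<in> J" using h by simp
  then show False using notin j by simp
qed

section \<open>The center of a group of prime power order\<close>

definition (in group) center :: "'a set" where
  "center = {z \<in> carrier G. \<forall>g\<in>carrier G. g \<otimes> z = z \<otimes> g}"

lemma (in group) subgroup_center: "subgroup center G"
proof (rule subgroupI)
  show "center \<noteq> {}" unfolding center_def by force
  show "inv a \<in> center" if "a \<in> center" for a
  proof -
    have "g \<otimes> inv a = inv a \<otimes> g" if "g \<in> carrier G" for g
      using that \<open>a \<in> center\<close> unfolding center_def
      by (smt (verit) inv_closed inv_inv inv_mult_group mem_Collect_eq)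
    then show ?thesis using that by (simp add: center_def)
  qed
  show "a \<otimes> b \<in> center" if "a \<in> center" "b \<in> center" for a b
  proof -
    have "g \<otimes> (a \<otimes> b) = a \<otimes> b \<otimes> g" if g: "g \<in> carrier G" for g
    proof -
      have "a \<in> carrier G" "b \<in> carrier G" "g \<otimes> a = a \<otimes> g" "g \<otimes> b = b \<otimes> g"
        using g \<open>a \<in> center\<close> \<open>b \<in> center\<close> by (auto simp: center_def)
      then show ?thesis using g by (metis m_assoc)
    qed
    moreover have "a \<otimes> b \<in> carrier G"
      using that unfolding center_def by blast
    ultimately show ?thesis by (simp add: center_def)
  qed
qed (auto simp: center_def)

text \<open>Class equation: the conjugacy classes outside the center have more than one element and
  size dividing a power of \<open>p\<close>, so \<open>p\<close> divides the number of noncentral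
  elements and with it the order of the center.\<close>

lemma (in group) prime_dvd_card_center:
  assumes p: "prime p" and ord: "order G = p ^ Suc n"
  shows "p dvd card center"
proof -
  have fin: "finite (carrier G)"
    using ord p by (metis order_gt_0_iff_finite prime_gt_0_nat zero_less_power)
  let ?c = "\<lambda>g. \<lambda>h\<in>carrier G. g \<otimes> h \<otimes> inv g"
  interpret a: group_action G "carrier G" ?c by (rule action_by_conjugation)
  define R where "R = orbit G ?c ` (carrier G - center)"
  have orb: "orbit G ?c x = {g \<otimes> x \<otimes> inv g | g. g \<in> carrier G}" if "x \<in> carrier G" for x
    using that by (simp add: orbit_def)
  have fix1: "x \<in> center" if x: "x \<in> carrier G" and "orbit G ?c x = {x}" for x
  proof -
    have "g \<otimes> x = x \<otimes> g" if g: "g \<in> carrier G" for g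
    proof -
      have "g \<otimes> x \<otimes> inv g = x" using \<open>orbit G ?c x = {x}\<close> orb[OF x] g by blast
      then show ?thesis using x g by (metis inv_solve_right' m_closed)
    qed
    then show ?thesis using x by (simp add: center_def)
  qed
  have centr: "orbit G ?c x = {x}" if x: "x \<in> center" for x
  proof -
    have xG: "x \<in> carrier G" and "\<And>g. g \<in> carrier G \<Longrightarrow> g \<otimes> x \<otimes> inv g = x"
      using x by (auto simp: center_def m_assoc)
    then have "orbit G ?c x \<subseteq> {x}" using orb by auto
    then show ?thesis using a.orbit_refl[OF xG] by blast
  qed
  have "x \<in> orbit G ?c x" if "x \<in> carrier G" for x
    using a.orbit_refl[OF that] by simp
  moreover have "y \<in> carrier G - center" if x: "x \<in> carrier G - center" and y: "y \<in> orbit G ?c x" for x y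
  proof -
    have yG: "y \<in> carrier G" using x y orb by auto
    have "x \<in> orbit G ?c y" using a.orbit_sym[of x y] x y yG by simp
    then show ?thesis using centr[of y] x yG by auto
  qed
  ultimately have un: "\<Union>R = carrier G - center" unfolding R_def by blast
  have "p dvd card (\<Union>R)"
  proof (rule dvd_partition)
    show "finite (\<Union>R)" using un fin by simp
    show "\<forall>c\<in>R. p dvd card c"
    proof
      fix c assume "c \<in> R"
      then obtain x where x: "x \<in> carrier G" "x \<notin> center" "c = orbit G ?c x" by (auto simp: R_def)
      have "card c * card (stabilizer G ?c x) = p ^ Suc n"
        using a.orbit_stabilizer_theorem[OF x(1)] x(3) ord by simp
      then have "card c dvd p ^ Suc n" by (rule dvdI[OF sym])
      then obtain i where i: "card c = p ^ i"
        using divides_primepow_nat[OF p] by blast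
      have "card c \<noteq> 1"
      proof
        assume "card c = 1"
        moreover have "x \<in> c" using a.orbit_refl[OF x(1)] x(3) by simp
        ultimately have "c = {x}" using card_1_singletonE by blast
        then show False using fix1 x by blast
      qed
      then have "i \<noteq> 0" using i by auto
      then show "p dvd card c" using i by (simp add: dvd_power)
    qed
    show "\<forall>c1\<in>R. \<forall>c2\<in>R. c1 \<noteq> c2 \<longrightarrow> c1 \<inter> c2 = {}"
      using a.disjoint_union unfolding R_def orbits_def by blast
  qed
  moreover have "card (carrier G) = card (carrier G - center) + card center"
    using card_Diff_subset[of center "carrier G"] subgroup.subset[OF subgroup_center] fin
    by (simp add: card_mono finite_subset)
  then have "card (carrier G - center) + card center = p ^ Suc n"
    using ord by (simp add: order_def)
  ultimately show ?thesis
    using un by (metis dvd_add_right_iff dvd_triv_left power_Suc)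
qed

section \<open>The Sylow subgroup for the largest prime\<close>

lemma (in group) eq_one_if_coprime_pows:
  assumes "x \<in> carrier G" "x [^] (m::nat) = \<one>" "x [^] (n::nat) = \<one>" "coprime m n"
  shows "x = \<one>"
proof -
  have "ord x dvd m" "ord x dvd n" using assms pow_eq_id by auto
  then have "ord x = 1" using assms(4) by (metis coprime_common_divisor_nat)
  then show ?thesis using ord_eq_1 assms(1) by blast
qed

text \<open>
  Describing the Sylow subgroup as a solution set makes it characteristic, so that it passes from
  a normal subgroup of index \<open>p \<noteq> q\<close> up to the whole group.
\<close>

lemma evolving_sylow_largest_prime:
  fixes G :: "('a, 'b) monoid_scheme"
  assumes "evolving G" "prime q" "\<And>p. \<lbrakk>prime p; p dvd order G\<rbrakk> \<Longrightarrow> p \<le> q"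
    "order G = q ^ a * m" "\<not> q dvd m"
  shows "subgroup {x \<in> carrier G. x [^]\<^bsub>G\<^esub> (q ^ a) = \<one>\<^bsub>G\<^esub>} G \<and>
    card {x \<in> carrier G. x [^]\<^bsub>G\<^esub> (q ^ a) = \<one>\<^bsub>G\<^esub>} = q ^ a"
  using assms
proof (induction "order G" arbitrary: G m rule: less_induct)
  case less
  note ev = less.prems(1) and q = less.prems(2) and big = less.prems(3)
    and ord = less.prems(4) and qm = less.prems(5)
  interpret group G using ev evolvingD by blast
  have fin: "finite (carrier G)" using ev evolvingD by blast
  then have o0: "order G \<noteq> 0" using order_gt_0_iff_finite by simp
  show ?case
  proof (cases "m = 1")
    case True
    then have "{x \<in> carrier G. x [^]\<^bsub>G\<^esub> (q ^ a) = \<one>\<^bsub>G\<^esub>} = carrier G"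
      using ord pow_order_eq_1 by auto
    then show ?thesis using ord True subgroup_self by (simp add: order_def)
  next
    case False
    define P where "P = (\<lambda>p. prime p \<and> p dvd order G)"
    define p where "p = (LEAST p. P p)"
    obtain p' where p': "prime p'" "p' dvd m" using False prime_factor_nat by blast
    then have "P p'" using ord by (simp add: P_def)
    then have "P p" and p_le: "\<And>r. P r \<Longrightarrow> p \<le> r"
      unfolding p_def by (auto intro: LeastI Least_le)
    then have p: "prime p" "p dvd order G" by (auto simp: P_def)
    \<comment> \<open>The nontrivial cofactor \<open>m\<close> supplies a prime divisor other than
      \<open>q\<close>, so the smallest prime \<open>p\<close> is strictly below
      \<open>q\<close>.\<close>
    have "p' \<noteq> q" "p' \<le> q" using p' qm big \<open>P p'\<close> by (auto simp: P_def)
    then have "p < q" using p_le[OF \<open>P p'\<close>] by simp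
    obtain b c where bc: "order G = p ^ b * c" "\<not> p dvd c"
      by (rule multiplicity_decompose'[of "order G" p]) (use o0 p in auto)
    obtain b' where b: "b = Suc b'" using bc p(2) by (cases b) auto
    \<comment> \<open>\<open>sylow_thm\<close> allows \<open>p\<close> to divide the cofactor, so it
      also yields the order \<open>p ^ b'\<close>, one power of \<open>p\<close> short of the
      maximum. As the index of \<open>I\<close> in \<open>J\<close> has no factor \<open>p\<close>,
      the missing one must be the whole index of \<open>J\<close>.\<close>
    obtain I where I: "subgroup I G" "card I = p ^ b'"
      using sylow_thm[OF p(1) is_group, of b' "p * c"] bc b fin by (auto simp: mult_ac)
    obtain J s k where J: "subgroup J G" "card (carrier G) = p ^ s * card J"
      "card J = k * card I" "coprime k p"
      using evolvingE[OF ev p(1) I] by metis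
    have "p ^ b' * (p * c) = order G" using bc(1) b by simp
    also have "\<dots> = p ^ b' * (p ^ s * k)"
      unfolding order_def J(2,3) I(2) by (simp only: mult_ac)
    finally have "p ^ b' * (p * c) = p ^ b' * (p ^ s * k)" .
    then have pc: "p * c = p ^ s * k" using p(1) by (simp add: prime_gt_0_nat)
    have npk: "\<not> p dvd k" using J(4) p(1) by (metis coprime_absorb_right not_prime_unit)
    have "s = 1"
    proof (cases s)
      case 0
      then have "p dvd k" using pc by (metis dvd_triv_left mult_1 power_0)
      then show ?thesis using npk by simp
    next
      case (Suc s')
      then have "c = p ^ s' * k" using pc p(1) by (simp add: prime_gt_0_nat)
      then show ?thesis using Suc bc(2) by (cases s') auto
    qed
    then have oJ: "order G = p * card J" using J(2) by (simp add: order_def)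
    then have nJ: "J \<lhd> G"
      by (rule smallest_prime_index_normal[OF fin J(1)]) (simp add: p_le P_def)
    interpret J: normal J G by fact
    interpret f: group_hom G "G Mod J" "\<lambda>a. J #>\<^bsub>G\<^esub> a" by (rule J.group_hom_Mod)
    let ?J = "G\<lparr>carrier := J\<rparr>"
    have Jpos: "0 < card J" using card_pos_subgroup[OF fin J(1)] .
    have "q ^ a dvd p * card J" using oJ ord by (metis dvd_triv_left)
    moreover have cop: "coprime (q ^ a) p"
      using p(1) q \<open>p < q\<close> by (simp add: primes_coprime)
    ultimately have "q ^ a dvd card J"
      using coprime_dvd_mult_right_iff by blast
    then obtain m' where m': "card J = q ^ a * m'" by blast
    then have "m = p * m'" using oJ ord q by (simp add: prime_gt_0_nat)
    then have qm': "\<not> q dvd m'" using qm by auto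
    have "order ?J < order G"
      using oJ Jpos prime_gt_1_nat[OF p(1)] by (simp add: order_def)
    moreover have "\<And>r. \<lbrakk>prime r; r dvd order ?J\<rbrakk> \<Longrightarrow> r \<le> q"
      using big oJ by (simp add: order_def)
    ultimately have IH: "subgroup {x \<in> carrier ?J. x [^]\<^bsub>?J\<^esub> (q ^ a) = \<one>\<^bsub>?J\<^esub>} ?J \<and>
        card {x \<in> carrier ?J. x [^]\<^bsub>?J\<^esub> (q ^ a) = \<one>\<^bsub>?J\<^esub>} = q ^ a"
      using less.hyps[of ?J m'] evolving_normal_subgroup[OF ev nJ] q m' qm'
      by (simp add: order_def)
    have "order (G Mod J) = p"
      using lagrange[OF J(1)] oJ Jpos by (simp add: order_def FactGroup_def)
    \<comment> \<open>The image of \<open>x\<close> in the quotient of order \<open>p\<close> has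
      order dividing both \<open>p\<close> and \<open>q ^ a\<close>, hence is trivial. So the
      equation has the same solutions in \<open>J\<close> as in \<open>G\<close>.\<close>
    then have "x \<in> J" if x: "x \<in> carrier G" "x [^]\<^bsub>G\<^esub> (q ^ a) = \<one>\<^bsub>G\<^esub>" for x
    proof -
      have "(J #>\<^bsub>G\<^esub> x) [^]\<^bsub>G Mod J\<^esub> (q ^ a) = \<one>\<^bsub>G Mod J\<^esub>"
        using J.FactGroup_pow[OF x(1)] x(2) J.subset by simp
      moreover have "(J #>\<^bsub>G\<^esub> x) [^]\<^bsub>G Mod J\<^esub> p = \<one>\<^bsub>G Mod J\<^esub>"
        using f.H.pow_order_eq_1 f.hom_closed[OF x(1)] \<open>order (G Mod J) = p\<close> by metis
      ultimately have "J #>\<^bsub>G\<^esub> x = \<one>\<^bsub>G Mod J\<^esub>"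
        using f.H.eq_one_if_coprime_pows[OF f.hom_closed[OF x(1)]] cop by blast
      then show ?thesis using coset_join1[OF _ x(1) J(1)] by simp
    qed
    then have "{x \<in> carrier ?J. x [^]\<^bsub>?J\<^esub> (q ^ a) = \<one>\<^bsub>?J\<^esub>} = {x \<in> carrier G. x [^]\<^bsub>G\<^esub> (q ^ a) = \<one>\<^bsub>G\<^esub>}"
      using J.subset by (auto simp flip: nat_pow_consistent)
    then show ?thesis using IH incl_subgroup[OF J(1)] by simp
  qed
qed

section \<open>A normal subgroup of prime order\<close>

lemma (in group) normal_pow_solutions:
  assumes "subgroup {x \<in> carrier G. x [^] (n::nat) = \<one>} G"
  shows "{x \<in> carrier G. x [^] n = \<one>} \<lhd> G"
proof (rule normal_invI[OF assms])
  fix x h assume x: "x \<in> carrier G" and h: "h \<in> {x \<in> carrier G. x [^] n = \<one>}"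
  have "(x \<otimes> h \<otimes> inv x) [^] k = x \<otimes> h [^] k \<otimes> inv x" for k :: nat
    using h x conjugation_pow by simp
  then show "x \<otimes> h \<otimes> inv x \<in> {x \<in> carrier G. x [^] n = \<one>}"
    using x h by simp
qed

text \<open>The normalizer of \<open>I\<close> contains \<open>A\<close> and \<open>B\<close>, so
  its order is divisible by the coprime numbers \<open>card A\<close> and \<open>m\<close>, hence by
  their product, the order of \<open>G\<close>.\<close>

lemma (in group) normal_if_coprime_normalizing:
  assumes fin: "finite (carrier G)" and I: "subgroup I G" and A: "subgroup A G" and B: "subgroup B G"
    and conj: "\<And>g x. \<lbrakk>g \<in> A \<union> B; x \<in> I\<rbrakk> \<Longrightarrow> g \<otimes> x \<otimes> inv g \<in> I"
    and ord: "order G = card A * m" "coprime (card A) m" "m dvd card B"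
  shows "I \<lhd> G"
proof -
  interpret I: subgroup I G by fact
  have finI: "finite I" using fin I.subset finite_subset by blast
  have sub: "C \<subseteq> normalizer G I" if C: "subgroup C G" "C \<subseteq> A \<union> B" for C
  proof
    fix g assume g: "g \<in> C"
    then have gG: "g \<in> carrier G" using subgroup.subset C by blast
    \<comment> \<open>Membership in \<open>normalizer\<close> demands equality of \<open>I\<close>
      with its conjugate. Conjugation by \<open>g\<close> is injective on the finite set
      \<open>I\<close>, so mapping \<open>I\<close> into itself suffices.\<close>
    have "g <# I #> inv g = (\<lambda>x. g \<otimes> x \<otimes> inv g) ` I"
      by (auto simp: l_coset_def r_coset_def)
    moreover have "(\<lambda>x. g \<otimes> x \<otimes> inv g) ` I = I"
      using conj g C gG finI by (intro endo_inj_surj) (auto intro!: inj_onI)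
    ultimately show "g \<in> normalizer G I"
      using gG I.subset by (simp add: normalizer_def stabilizer_def)
  qed
  have N: "subgroup (normalizer G I) G" using normalizer_imp_subgroup[OF I.subset] .
  have "card A dvd card (normalizer G I)" "card B dvd card (normalizer G I)"
    using lagrange_pair[OF A N sub[OF A]] lagrange_pair[OF B N sub[OF B]]
    by (metis Un_upper1 dvd_triv_right, metis Un_upper2 dvd_triv_right)
  then have "order G dvd card (normalizer G I)"
    using ord by (metis divides_mult dvd_trans)
  then have NG: "normalizer G I = carrier G"
    using card_pos_subgroup[OF fin N] fin subgroup.subset[OF N]
    by (metis card_seteq dvd_imp_le order_def)
  show ?thesis
  proof (intro normal_invI[OF I])
    fix x h assume x: "x \<in> carrier G" and h: "h \<in> I"
    have "x <# I #> inv x = I"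
      using x NG I.subset
      by (auto simp: normalizer_def stabilizer_def)
    then show "x \<otimes> h \<otimes> inv x \<in> I"
      using h by (auto simp: l_coset_def r_coset_def)
  qed
qed

lemma evolving_prime_normal_subgroup:
  fixes G (structure)
  assumes ev: "evolving G" and nontriv: "order G \<noteq> 1"
  obtains I where "I \<lhd> G" "prime (card I)"
proof -
  interpret group G using ev evolvingD by blast
  have fin: "finite (carrier G)" using ev evolvingD by blast
  then have o0: "order G \<noteq> 0" using order_gt_0_iff_finite by simp
  define q where "q = Max (prime_factors (order G))"
  have ne: "prime_factors (order G) \<noteq> {}"
    using nontriv o0 by (simp add: prime_factorization_empty_iff)
  then have "q \<in> prime_factors (order G)" unfolding q_def by (intro Max_in) auto
  then have q: "prime q" "q dvd order G" by (auto dest: in_prime_factors_imp_prime in_prime_factors_imp_dvd)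
  have big: "r \<le> q" if "prime r" "r dvd order G" for r
    using that o0 unfolding q_def by (intro Max_ge) (auto simp: in_prime_factors_iff)
  obtain a m where am: "order G = q ^ a * m" "\<not> q dvd m"
    by (rule multiplicity_decompose'[of "order G" q]) (use o0 q in auto)
  obtain a' where a': "a = Suc a'" using am q(2) by (cases a) auto
  obtain Q where Q: "Q \<lhd> G" "card Q = q ^ a"
    using evolving_sylow_largest_prime[OF ev q(1) big am] normal_pow_solutions by blast
  interpret Q: normal Q G by fact
  let ?Q = "G\<lparr>carrier := Q\<rparr>"
  interpret GQ: group ?Q using subgroup_imp_group[OF Q.subgroup_axioms] .
  have finQ: "finite Q" using fin Q.subset finite_subset by blast
  have "q dvd card GQ.center"
    using GQ.prime_dvd_card_center[OF q(1), of a'] Q(2) a' by (simp add: order_def)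
  then obtain c where c: "card GQ.center = q * c" by blast
  let ?Z = "?Q\<lparr>carrier := GQ.center\<rparr>"
  have Zsub: "GQ.center \<subseteq> Q" using subgroup.subset[OF GQ.subgroup_center] by simp
  have "finite GQ.center" using finQ Zsub finite_subset by blast
  \<comment> \<open>With exponent 1, \<open>sylow_thm\<close> acts as Cauchy's theorem for the
    center of \<open>Q\<close>.\<close>
  then obtain I where IZ: "subgroup I ?Z" "card I = q ^ 1"
    using sylow_thm[OF q(1) GQ.subgroup_imp_group[OF GQ.subgroup_center], of 1 c] c
    by (auto simp: order_def)
  have IsubZ: "I \<subseteq> GQ.center" using subgroup.subset[OF IZ(1)] by simp
  have IQ: "I \<subseteq> Q" using IsubZ Zsub by blast
  have I: "subgroup I G"
    using GQ.incl_subgroup[OF GQ.subgroup_center IZ(1)] incl_subgroup[OF Q.subgroup_axioms] by blast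
  obtain J s k where J: "subgroup J G" "I \<subseteq> J" "card (carrier G) = q ^ s * card J"
    "card J = k * card I" "coprime k q"
    using evolvingE[OF ev q(1) I IZ(2)] .
  \<comment> \<open>The order of \<open>Q \<inter> J\<close> is a power of \<open>q\<close> dividing
    \<open>k * q\<close> with \<open>k\<close> coprime to \<open>q\<close>. It is therefore at most
    \<open>q\<close>, the order of the subgroup \<open>I\<close> that it contains.\<close>
  have QJ: "subgroup (Q \<inter> J) G" using subgroups_Inter_pair[OF Q.subgroup_axioms J(1)] .
  have "card (Q \<inter> J) dvd q ^ a"
    using lagrange_pair[OF QJ Q.subgroup_axioms] Q(2) by (metis Int_lower1 dvd_triv_right)
  then obtain i where i: "card (Q \<inter> J) = q ^ i"
    using divides_primepow_nat[OF q(1)] by blast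
  have "q ^ i dvd k * q"
    using lagrange_pair[OF QJ J(1)] J(4) IZ(2) i by (metis Int_lower2 dvd_triv_right power_one_right)
  then have "q ^ i dvd q" using J(5)
    by (metis coprime_commute coprime_dvd_mult_right_iff coprime_power_left_iff)
  then have "card (Q \<inter> J) \<le> card I"
    using i IZ(2) q(1) by (simp add: dvd_imp_le prime_gt_0_nat)
  then have IeqQJ: "I = Q \<inter> J"
    using IQ J(2) finQ by (intro card_seteq) auto
  have m: "m dvd card J"
  proof -
    have "q ^ a * m = q ^ s * card J" using am J(3) by (simp add: order_def)
    moreover have "coprime m (q ^ s)" using am(2) q(1)
      by (metis coprime_commute coprime_power_right_iff prime_imp_coprime)
    ultimately show ?thesis
      by (metis coprime_dvd_mult_right_iff dvd_triv_right)
  qed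
  \<comment> \<open>Elements of \<open>Q\<close> centralize \<open>I\<close>; elements of
    \<open>J\<close> preserve both \<open>J\<close> and the normal subgroup \<open>Q\<close>, hence
    the intersection \<open>I\<close>.\<close>
  have "g \<otimes> x \<otimes> inv g \<in> I" if "g \<in> Q \<union> J" "x \<in> I" for g x
    using that(1)
  proof
    assume g: "g \<in> Q"
    then have "g \<otimes> x = x \<otimes> g" "g \<in> carrier G" "x \<in> carrier G"
      using that(2) IsubZ IQ Q.subset by (auto simp: GQ.center_def)
    then show ?thesis using that(2) by (simp add: m_assoc)
  next
    assume g: "g \<in> J"
    interpret J: subgroup J G by fact
    show ?thesis using that(2) g Q.inv_op_closed2[of g x] unfolding IeqQJ by simp
  qed
  moreover have "coprime (card Q) m" using am(2) q(1) Q(2)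
    by (metis coprime_power_left_iff prime_imp_coprime)
  ultimately have "I \<lhd> G"
    using normal_if_coprime_normalizing[OF fin I Q.subgroup_axioms J(1), of m] am(1) Q(2) m by simp
  then show ?thesis using that IZ(2) q(1) by simp
qed

section \<open>Construction of the normal series\<close>

lemma (in group) prime_order_cyclic:
  assumes "prime (order G)"
  shows "cyclic_group G"
proof -
  have fin: "finite (carrier G)" using assms by (metis card.infinite not_prime_0 order_def)
  have "order G \<noteq> 1" using assms by auto
  then obtain x where x: "x \<in> carrier G" "x \<noteq> \<one>"
    using order_one_triv_iff by auto
  have sub: "subgroup (generate G {x}) G" using x generate_is_subgroup by simp
  have "card (generate G {x}) dvd order G"
    using lagrange[OF sub] by (metis dvd_triv_right)
  moreover have "card (generate G {x}) \<noteq> 1"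
  proof
    assume "card (generate G {x}) = 1"
    moreover have "{x, \<one>} \<subseteq> generate G {x}" by (simp add: generate.incl generate.one)
    ultimately show False using x(2) by (metis card_1_singletonE insert_subset singletonD)
  qed
  ultimately have "card (generate G {x}) = card (carrier G)"
    using assms by (metis order_def prime_nat_iff)
  then have "generate G {x} = carrier G"
    using fin subgroup.subset[OF sub] card_subset_eq by blast
  then have "subgroup_generated G {x} = G"
    using x(1) by (simp add: subgroup_generated_def)
  then show ?thesis using x(1) by (auto simp: cyclic_group_def)
qed

text \<open>The quotient \<open>G Mod N\<close> is evolving and nontrivial, so it has a normal
  subgroup of prime order; \<open>M\<close> is the preimage of that subgroup.\<close>

lemma evolving_cyclic_step:
  fixes G (structure)
  assumes ev: "evolving G" and N: "N \<lhd> G" and "N \<noteq> carrier G"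
  obtains M where "M \<lhd> G" "N \<subset> M" "cyclic_group (G\<lparr>carrier := M\<rparr> Mod N)"
proof -
  interpret N: normal N G by fact
  interpret f: group_hom G "G Mod N" "\<lambda>a. N #> a" by (rule N.group_hom_Mod)
  have fin: "finite (carrier G)" using ev evolvingD by blast
  have surj: "(\<lambda>a. N #> a) ` carrier G = carrier (G Mod N)"
    by (simp add: carrier_FactGroup)
  have evQ: "evolving (G Mod N)"
    using evolving_epimorphic_image[OF ev f.group_hom_axioms surj] .
  have "order (G Mod N) \<noteq> 1"
    using N.fact_group_trivial_iff[OF fin] f.H.order_one_triv_iff \<open>N \<noteq> carrier G\<close> by simp
  then obtain I where I: "I \<lhd> (G Mod N)" "prime (card I)"
    using evolving_prime_normal_subgroup[OF evQ] by blast
  interpret I: normal I "G Mod N" by fact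
  define M where "M = {x \<in> carrier G. N #> x \<in> I}"
  have Ms: "subgroup M G" unfolding M_def using f.subgroup_preimage[OF I.subgroup_axioms] .
  have M: "M \<lhd> G"
  proof (rule N.normal_invI[OF Ms])
    fix x y assume x: "x \<in> carrier G" and y: "y \<in> M"
    then have "N #> (x \<otimes> y \<otimes> inv x) \<in> I"
      using I.inv_op_closed2[of "N #> x" "N #> y"] f.hom_closed f.hom_mult f.hom_inv
      by (simp add: M_def)
    then show "x \<otimes> y \<otimes> inv x \<in> M" using x y by (simp add: M_def)
  qed
  have fM: "(\<lambda>a. N #> a) ` M = I"
  proof (intro equalityI subsetI)
    fix X assume X: "X \<in> I"
    then have "X \<in> (\<lambda>a. N #> a) ` carrier G" using I.subset surj by blast
    then show "X \<in> (\<lambda>a. N #> a) ` M" using X by (auto simp: M_def)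
  qed (auto simp: M_def)
  have "N \<subseteq> M"
  proof
    fix x assume x: "x \<in> N"
    then have "N #> x = \<one>\<^bsub>G Mod N\<^esub>"
      using N.coset_join2[OF _ N.subgroup_axioms x] by simp
    then show "x \<in> M" using x I.one_closed unfolding M_def by simp
  qed
  let ?F = "G\<lparr>carrier := M\<rparr> Mod N"
  have "carrier ?F = I"
    using fM by (simp add: carrier_FactGroup)
  then have "prime (order ?F)" using I(2) by (simp add: order_def)
  moreover have "N \<lhd> G\<lparr>carrier := M\<rparr>"
    using N.normal_restrict_supergroup[OF Ms N \<open>N \<subseteq> M\<close>] .
  ultimately have "cyclic_group ?F"
    using group.prime_order_cyclic normal.factorgroup_is_group by blast
  \<comment> \<open>If the two were equal, \<open>I\<close> would consist of the single coset
    \<open>N\<close>, contrary to its prime order.\<close>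
  moreover have "N \<noteq> M"
  proof
    assume "N = M"
    have "(\<lambda>a. N #> a) ` N \<subseteq> {N}"
      using N.coset_join2[OF _ N.subgroup_axioms] by auto
    then have "card I \<le> 1"
      using fM \<open>N = M\<close> using card_mono[of "{N}" I] by simp
    then show False using prime_gt_1_nat[OF I(2)] by simp
  qed
  ultimately show ?thesis using that M \<open>N \<subseteq> M\<close> by blast
qed

text \<open>Starting from an arbitrary normal \<open>N\<close> lets the induction proceed upwards
  inside one fixed \<open>G\<close>: every term is normal in \<open>G\<close> from the outset, and
  no series has to be pulled back from a quotient.\<close>

lemma evolving_series_above:
  fixes G (structure)
  assumes ev: "evolving G" and "N \<lhd> G"
  shows "\<exists>(S :: nat \<Rightarrow> 'a set) r. S 0 = N \<and> S r = carrier G \<and> (\<forall>i\<le>r. S i \<lhd> G) \<and>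
      (\<forall>i<r. S i \<subseteq> S (Suc i) \<and> cyclic_group (G\<lparr>carrier := S (Suc i)\<rparr> Mod S i))"
  using \<open>N \<lhd> G\<close>
proof (induction "order G - card N" arbitrary: N rule: less_induct)
  case less
  show ?case
  proof (cases "N = carrier G")
    case True
    then show ?thesis using less.prems by (intro exI[of _ "\<lambda>_. N"] exI[of _ 0]) simp
  next
    case False
    obtain M where M: "M \<lhd> G" "N \<subset> M" "cyclic_group (G\<lparr>carrier := M\<rparr> Mod N)"
      using evolving_cyclic_step[OF ev less.prems False] .
    have fin: "finite (carrier G)" using ev evolvingD by blast
    have MG: "M \<subseteq> carrier G" using M(1) by (simp add: normal_imp_subgroup subgroup.subset)
    then have "card N < card M" "card M \<le> order G"
      using M(2) fin by (auto simp: order_def intro: psubset_card_mono card_mono finite_subset)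
    then have "order G - card M < order G - card N" by simp
    from less.hyps[OF this M(1)] obtain S r where S: "S 0 = M" "S r = carrier G" "\<forall>i\<le>r. S i \<lhd> G"
      "\<forall>i<r. S i \<subseteq> S (Suc i) \<and> cyclic_group (G\<lparr>carrier := S (Suc i)\<rparr> Mod S i)"
      by blast
    \<comment> \<open>The series above \<open>M\<close> is shifted by one place to put
      \<open>N\<close> in front.\<close>
    let ?S = "\<lambda>i. case i of 0 \<Rightarrow> N | Suc j \<Rightarrow> S j"
    have "?S 0 = N" "?S (Suc r) = carrier G" using S by auto
    moreover have "\<forall>i\<le>Suc r. ?S i \<lhd> G" using S less.prems by (auto split: nat.split)
    moreover have "\<forall>i<Suc r. ?S i \<subseteq> ?S (Suc i) \<and> cyclic_group (G\<lparr>carrier := ?S (Suc i)\<rparr> Mod ?S i)"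
      using S M by (auto split: nat.split)
    ultimately show ?thesis by blast
  qed
qed

theorem proposition3:
  fixes G :: "('a, 'b) monoid_scheme"
  assumes "evolving G"
  shows "supersolvable G"
proof -
  interpret group G using assms evolvingD by blast
  show ?thesis
    unfolding supersolvable_def
    using is_group evolving_series_above[OF assms one_is_normal] by blast
qed

end
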